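(* Let $\Bbbk$ be a commutative ring with $1$ and let $n\ge1$, $r\ge0$ be integers. Let $\mathcal{O}(n,r)\subset[n]^r$ be any set of representatives for the $\mathfrak{S}_r$-orbits on $[n]^r$. For every $w\in\mathcal{C}_{n,r}$, the canonical basis element $\bar{w}$, viewed in the Schur algebra $S(n,r)$, satisfies $$\bar{w}=\sum_{\underline{i}\in\mathcal{O}(n,r)}\xi_{w(\underline{i}),\underline{i}}.$$
   Context: $[n]=\{1,\dots,n\}$; $\mathfrak{S}_r$ and $W_n$ are the symmetric groups on $[r]$ and $[n]$. $\mathfrak{S}_r$ acts on $[n]^r$ on the right by $\underline{j}\,\sigma=(j_{\sigma(1)},\dots,j_{\sigma(r)})$; $\Lambda(n,r)$ denotes the set of orbits. For $w\in W_n$, $w(\underline{j})=(w(j_1),\dots,w(j_r))$. $\mathcal{C}_{n,r}$ is the set of $w\in W_n$ whose longest increasing subsequence (in one-line notation) has length at least $n-r$. $\mathbf{V}$ is a free $\Bbbk$-module with basis $\mathbf{v}_1,\dots,\mathbf{v}_n$, and $\mathbf{v}_{\underline{j}}=\mathbf{v}_{j_1}\otimes\cdots\otimes\mathbf{v}_{j_r}$. $\mathfrak{S}_r$ acts on $\mathbf{V}^{\otimes r}$ by $\mathbf{v}_{\underline{j}}\cdot\sigma=\mathbf{v}_{\underline{j}\sigma}$, and $S(n,r)=\operatorname{End}_{\mathfrak{S}_r}(\mathbf{V}^{\otimes r})$. $\Psi:\Bbbk[W_n]\to\operatorname{End}_\Bbbk(\mathbf{V}^{\otimes r})$ is the representation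 $\Psi(w)\mathbf{v}_{\underline{j}}=\mathbf{v}_{w(\underline{j})}$. Its image lies in $S(n,r)$, so $\mathbf{C}(n,r)=\Bbbk[W_n]/\ker\Psi$ is identified with a subalgebra of $S(n,r)$; under this identification the coset $\bar{w}=w+\ker\Psi$ corresponds to $\Psi(w)$. Green's basis: for $\underline{i},\underline{j}\in[n]^r$, $\xi_{\underline{i},\underline{j}}\in S(n,r)$ is the operator whose matrix with respect to the basis $\{\mathbf{v}_{\underline{j}}\}$ has $(\underline{p},\underline{q})$ entry (the coefficient of $\mathbf{v}_{\underline{p}}$ in the image of $\mathbf{v}_{\underline{q}}$) equal to $1$ if $(\underline{p},\underline{q})=(\underline{i}\,\sigma,\underline{j}\,\sigma)$ for some $\sigma\in\mathfrak{S}_r$, and $0$ otherwise. *)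

theory Defs
  imports
    "HOL-Algebra.Sym_Groups"
    "HOL-Algebra.Group_Action"
    "HOL-Algebra.QuotRing"
    "HOL-Algebra.Module"
    "HOL-Library.Sublist"
begin

section \<open>Multi-indices and permutations\<close>

text \<open>A tuple in \<open>[n]\<^sup>r\<close> is an extensional function on \<open>{1..r}\<close>. Both \<open>\<SS>\<^sub>r\<close> and \<open>W\<^sub>n\<close> are
  instances of \<^const>\<open>sym_group\<close>.\<close>

definition multi_index :: "nat \<Rightarrow> nat \<Rightarrow> (nat \<Rightarrow> nat) set"
  where "multi_index n r = {1..r} \<rightarrow>\<^sub>E {1..n}"

definition place_act :: "nat \<Rightarrow> (nat \<Rightarrow> nat) \<Rightarrow> (nat \<Rightarrow> nat) \<Rightarrow> nat \<Rightarrow> nat"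
  where "place_act r \<sigma> j = (\<lambda>k\<in>{1..r}. j (\<sigma> k))"

definition value_act :: "nat \<Rightarrow> (nat \<Rightarrow> nat) \<Rightarrow> (nat \<Rightarrow> nat) \<Rightarrow> nat \<Rightarrow> nat"
  where "value_act r w j = (\<lambda>k\<in>{1..r}. w (j k))"

text \<open>The place permutation action is a right action; \<^const>\<open>orbits\<close> only forms the sets
  \<open>{j\<sigma> | \<sigma>}\<close>, for which the side does not matter.\<close>

definition place_orbits :: "nat \<Rightarrow> nat \<Rightarrow> (nat \<Rightarrow> nat) set set"
  where "place_orbits n r = orbits (sym_group r) (multi_index n r) (place_act r)"

definition one_line :: "nat \<Rightarrow> (nat \<Rightarrow> nat) \<Rightarrow> nat list"
  where "one_line n w = map w [1..<Suc n]"

definition lis_length :: "nat list \<Rightarrow> nat"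
  where "lis_length xs = Max {length ys | ys. subseq ys xs \<and> sorted_wrt (<) ys}"

definition lis_perms :: "nat \<Rightarrow> nat \<Rightarrow> (nat \<Rightarrow> nat) set"
  where "lis_perms n r =
    {w \<in> carrier (sym_group n). int n - int r \<le> int (lis_length (one_line n w))}"


section \<open>Free modules, endomorphisms and group algebras\<close>

text \<open>The free \<open>R\<close>-module on a finite set \<open>B\<close>, in coordinates. The fields \<open>mult\<close> and
  \<open>one\<close>, which \<^typ>\<open>('a, 'b) module\<close> inherits from rings, play no role for a module.\<close>

definition free_module :: "('a, 'm) ring_scheme \<Rightarrow> 'b set \<Rightarrow> ('a, 'b \<Rightarrow> 'a) module"
  where "free_module R B =
    \<lparr>carrier = B \<rightarrow>\<^sub>E carrier R, mult = undefined, one = undefined,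
     zero = (\<lambda>b\<in>B. \<zero>\<^bsub>R\<^esub>), add = (\<lambda>x y. \<lambda>b\<in>B. x b \<oplus>\<^bsub>R\<^esub> y b),
     smult = (\<lambda>a x. \<lambda>b\<in>B. a \<otimes>\<^bsub>R\<^esub> x b)\<rparr>"

definition basis_vec :: "('a, 'm) ring_scheme \<Rightarrow> 'b set \<Rightarrow> 'b \<Rightarrow> 'b \<Rightarrow> 'a"
  where "basis_vec R B b = (\<lambda>c\<in>B. if c = b then \<one>\<^bsub>R\<^esub> else \<zero>\<^bsub>R\<^esub>)"

text \<open>The linear map from the free module on \<open>B\<close> to \<open>M\<close> that sends the basis vector of \<open>b\<close> to
  \<open>f b\<close>.\<close>

definition lin_ext ::
    "('a, 'm) ring_scheme \<Rightarrow> 'b set \<Rightarrow> ('a, 'c, 'k) module_scheme \<Rightarrow> ('b \<Rightarrow> 'c) \<Rightarrow> ('b \<Rightarrow> 'a) \<Rightarrow> 'c"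
  where "lin_ext R B M f =
    (\<lambda>x\<in>carrier (free_module R B). \<Oplus>\<^bsub>M\<^esub>b\<in>B. x b \<odot>\<^bsub>M\<^esub> f b)"

definition End_algebra ::
    "('a, 'm) ring_scheme \<Rightarrow> ('a, 'c, 'k) module_scheme \<Rightarrow> ('a, 'c \<Rightarrow> 'c) module"
  where "End_algebra R M =
    \<lparr>carrier = {f \<in> carrier M \<rightarrow>\<^sub>E carrier M.
        (\<forall>x\<in>carrier M. \<forall>y\<in>carrier M. f (x \<oplus>\<^bsub>M\<^esub> y) = f x \<oplus>\<^bsub>M\<^esub> f y) \<and>
        (\<forall>a\<in>carrier R. \<forall>x\<in>carrier M. f (a \<odot>\<^bsub>M\<^esub> x) = a \<odot>\<^bsub>M\<^esub> f x)},
     mult = (\<lambda>f g. compose (carrier M) f g), one = (\<lambda>x\<in>carrier M. x),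
     zero = (\<lambda>x\<in>carrier M. \<zero>\<^bsub>M\<^esub>), add = (\<lambda>f g. \<lambda>x\<in>carrier M. f x \<oplus>\<^bsub>M\<^esub> g x),
     smult = (\<lambda>a f. \<lambda>x\<in>carrier M. a \<odot>\<^bsub>M\<^esub> f x)\<rparr>"

definition group_algebra ::
    "('a, 'm) ring_scheme \<Rightarrow> ('g, 'k) monoid_scheme \<Rightarrow> ('a, 'g \<Rightarrow> 'a) module"
  where "group_algebra R G = (free_module R (carrier G))
    \<lparr>mult := (\<lambda>x y. \<lambda>g\<in>carrier G. \<Oplus>\<^bsub>R\<^esub>h\<in>carrier G. x h \<otimes>\<^bsub>R\<^esub> y (inv\<^bsub>G\<^esub> h \<otimes>\<^bsub>G\<^esub> g)),
     one := basis_vec R (carrier G) \<one>\<^bsub>G\<^esub>\<rparr>"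


section \<open>Tensor space and the Schur algebra\<close>

text \<open>\<open>V\<close> is \<open>free_module R {1..n}\<close>. Its \<open>r\<close>-th tensor power is taken in the coordinates given by
  the basis \<open>v\<^sub>j = v\<^bsub>j\<^sub>1\<^esub> \<otimes> \<dots> \<otimes> v\<^bsub>j\<^sub>r\<^esub>\<close>, so that the coordinates of \<open>x\<^sub>1 \<otimes> \<dots> \<otimes> x\<^sub>r\<close> are
  the products of coordinates of the factors.\<close>

definition tensor_power ::
    "('a, 'm) ring_scheme \<Rightarrow> nat \<Rightarrow> nat \<Rightarrow> ('a, (nat \<Rightarrow> nat) \<Rightarrow> 'a) module"
  where "tensor_power R n r = free_module R (multi_index n r)"

definition pure_tensor ::
    "('a, 'm) ring_scheme \<Rightarrow> nat \<Rightarrow> nat \<Rightarrow> (nat \<Rightarrow> nat \<Rightarrow> 'a) \<Rightarrow> (nat \<Rightarrow> nat) \<Rightarrow> 'a"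
  where "pure_tensor R n r x = (\<lambda>p\<in>multi_index n r. \<Otimes>\<^bsub>R\<^esub>k\<in>{1..r}. x k (p k))"

definition tensor_vec ::
    "('a, 'm) ring_scheme \<Rightarrow> nat \<Rightarrow> nat \<Rightarrow> (nat \<Rightarrow> nat) \<Rightarrow> (nat \<Rightarrow> nat) \<Rightarrow> 'a"
  where "tensor_vec R n r j = pure_tensor R n r (\<lambda>k. basis_vec R {1..n} (j k))"

lemma tensor_vec_eq_basis_vec:
  assumes "cring R" and j: "j \<in> multi_index n r"
  shows "tensor_vec R n r j = basis_vec R (multi_index n r) j"
proof -
  interpret cring R by fact
  have "(\<Otimes>\<^bsub>R\<^esub>k\<in>{1..r}. basis_vec R {1..n} (j k) (p k)) = (if p = j then \<one>\<^bsub>R\<^esub> else \<zero>\<^bsub>R\<^esub>)"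
    if p: "p \<in> multi_index n r" for p
  proof -
    have mem: "p k \<in> {1..n}" if "k \<in> {1..r}" for k
      using p that by (auto simp: multi_index_def)
    have closed: "(\<lambda>k. basis_vec R {1..n} (j k) (p k)) \<in> A \<rightarrow> carrier R" if "A \<subseteq> {1..r}" for A
      using that mem by (auto simp: basis_vec_def subset_iff)
    show ?thesis
    proof (cases "p = j")
      case True
      then have "(\<Otimes>\<^bsub>R\<^esub>k\<in>{1..r}. basis_vec R {1..n} (j k) (p k)) = (\<Otimes>\<^bsub>R\<^esub>k\<in>{1..r}. \<one>\<^bsub>R\<^esub>)"
        using mem by (intro finprod_cong') (auto simp: basis_vec_def)
      then show ?thesis using True by simp
    next
      case False
      then obtain k where k: "k \<in> {1..r}" "p k \<noteq> j k"
        using p j unfolding multi_index_def by (meson PiE_ext)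
      have "(\<Otimes>\<^bsub>R\<^esub>k\<in>insert k ({1..r} - {k}). basis_vec R {1..n} (j k) (p k)) =
          basis_vec R {1..n} (j k) (p k) \<otimes>\<^bsub>R\<^esub>
          (\<Otimes>\<^bsub>R\<^esub>k\<in>{1..r} - {k}. basis_vec R {1..n} (j k) (p k))"
        using closed[of "{1..r} - {k}"] closed[of "{k}"] k(1)
        by (intro finprod_insert) auto
      moreover have "basis_vec R {1..n} (j k) (p k) = \<zero>\<^bsub>R\<^esub>"
        using k mem by (auto simp: basis_vec_def)
      moreover have "(\<Otimes>\<^bsub>R\<^esub>k\<in>{1..r} - {k}. basis_vec R {1..n} (j k) (p k)) \<in> carrier R"
        using closed[of "{1..r} - {k}"] by (intro finprod_closed) auto
      ultimately show ?thesis using False k(1) by (simp add: insert_absorb)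
    qed
  qed
  then show ?thesis
    by (auto simp: tensor_vec_def pure_tensor_def basis_vec_def[of _ "multi_index n r"] fun_eq_iff)
qed

text \<open>The operator on tensor space that sends \<open>v\<^sub>j\<close> to \<open>f j\<close>.\<close>

abbreviation tensor_op ::
    "('a, 'm) ring_scheme \<Rightarrow> nat \<Rightarrow> nat \<Rightarrow> ((nat \<Rightarrow> nat) \<Rightarrow> (nat \<Rightarrow> nat) \<Rightarrow> 'a) \<Rightarrow>
      ((nat \<Rightarrow> nat) \<Rightarrow> 'a) \<Rightarrow> (nat \<Rightarrow> nat) \<Rightarrow> 'a"
  where "tensor_op R n r f \<equiv> lin_ext R (multi_index n r) (tensor_power R n r) f"

definition place_op ::
    "('a, 'm) ring_scheme \<Rightarrow> nat \<Rightarrow> nat \<Rightarrow> (nat \<Rightarrow> nat) \<Rightarrow>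
      ((nat \<Rightarrow> nat) \<Rightarrow> 'a) \<Rightarrow> (nat \<Rightarrow> nat) \<Rightarrow> 'a"
  where "place_op R n r \<sigma> = tensor_op R n r (\<lambda>j. tensor_vec R n r (place_act r \<sigma> j))"

definition schur_algebra ::
    "('a, 'm) ring_scheme \<Rightarrow> nat \<Rightarrow> nat \<Rightarrow> ('a, ((nat \<Rightarrow> nat) \<Rightarrow> 'a) \<Rightarrow> (nat \<Rightarrow> nat) \<Rightarrow> 'a) module"
  where "schur_algebra R n r = (End_algebra R (tensor_power R n r))
    \<lparr>carrier := {f \<in> carrier (End_algebra R (tensor_power R n r)).
       \<forall>\<sigma>\<in>carrier (sym_group r). \<forall>x\<in>carrier (tensor_power R n r).
         f (place_op R n r \<sigma> x) = place_op R n r \<sigma> (f x)}\<rparr>"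

text \<open>Green's basis element: the matrix column at \<open>q\<close> is the image of \<open>v\<^sub>q\<close>.\<close>

definition green_xi ::
    "('a, 'm) ring_scheme \<Rightarrow> nat \<Rightarrow> nat \<Rightarrow> (nat \<Rightarrow> nat) \<Rightarrow> (nat \<Rightarrow> nat) \<Rightarrow>
      ((nat \<Rightarrow> nat) \<Rightarrow> 'a) \<Rightarrow> (nat \<Rightarrow> nat) \<Rightarrow> 'a"
  where "green_xi R n r i j = tensor_op R n r (\<lambda>q. \<lambda>p\<in>multi_index n r.
    if \<exists>\<sigma>\<in>carrier (sym_group r). (p, q) = (place_act r \<sigma> i, place_act r \<sigma> j)
    then \<one>\<^bsub>R\<^esub> else \<zero>\<^bsub>R\<^esub>)"


section \<open>The representation of the group algebra and its quotient\<close>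

definition perm_op ::
    "('a, 'm) ring_scheme \<Rightarrow> nat \<Rightarrow> nat \<Rightarrow> (nat \<Rightarrow> nat) \<Rightarrow>
      ((nat \<Rightarrow> nat) \<Rightarrow> 'a) \<Rightarrow> (nat \<Rightarrow> nat) \<Rightarrow> 'a"
  where "perm_op R n r w = tensor_op R n r (\<lambda>j. tensor_vec R n r (value_act r w j))"

definition Psi ::
    "('a, 'm) ring_scheme \<Rightarrow> nat \<Rightarrow> nat \<Rightarrow> ((nat \<Rightarrow> nat) \<Rightarrow> 'a) \<Rightarrow>
      ((nat \<Rightarrow> nat) \<Rightarrow> 'a) \<Rightarrow> (nat \<Rightarrow> nat) \<Rightarrow> 'a"
  where "Psi R n r = lin_ext R (carrier (sym_group n)) (End_algebra R (tensor_power R n r))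
    (perm_op R n r)"

definition ker_Psi :: "('a, 'm) ring_scheme \<Rightarrow> nat \<Rightarrow> nat \<Rightarrow> ((nat \<Rightarrow> nat) \<Rightarrow> 'a) set"
  where "ker_Psi R n r =
    a_kernel (group_algebra R (sym_group n)) (End_algebra R (tensor_power R n r)) (Psi R n r)"

definition C_algebra :: "('a, 'm) ring_scheme \<Rightarrow> nat \<Rightarrow> nat \<Rightarrow> ((nat \<Rightarrow> nat) \<Rightarrow> 'a) set ring"
  where "C_algebra R n r = group_algebra R (sym_group n) Quot ker_Psi R n r"

definition bar :: "('a, 'm) ring_scheme \<Rightarrow> nat \<Rightarrow> nat \<Rightarrow> (nat \<Rightarrow> nat) \<Rightarrow> ((nat \<Rightarrow> nat) \<Rightarrow> 'a) set"
  where "bar R n r w =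
    ker_Psi R n r +>\<^bsub>group_algebra R (sym_group n)\<^esub> basis_vec R (carrier (sym_group n)) w"

text \<open>The identification of \<^const>\<open>C_algebra\<close> with a subalgebra of \<^const>\<open>schur_algebra\<close>: \<open>\<Psi>\<close> is
  constant on each coset of its kernel, and the coset is sent to that value.\<close>

definition to_schur ::
    "('a, 'm) ring_scheme \<Rightarrow> nat \<Rightarrow> nat \<Rightarrow> ((nat \<Rightarrow> nat) \<Rightarrow> 'a) set \<Rightarrow>
      ((nat \<Rightarrow> nat) \<Rightarrow> 'a) \<Rightarrow> (nat \<Rightarrow> nat) \<Rightarrow> 'a"
  where "to_schur R n r X = the_elem (Psi R n r ` X)"

lemma bar_in_C_algebra:
  assumes "cring R" and w: "w \<in> carrier (sym_group n)"
  shows "bar R n r w \<in> carrier (C_algebra R n r)"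
proof -
  interpret cring R by fact
  have "basis_vec R (carrier (sym_group n)) w \<in> carrier (group_algebra R (sym_group n))"
    by (auto simp: basis_vec_def group_algebra_def free_module_def)
  then show ?thesis
    by (auto simp: bar_def C_algebra_def FactRing_def A_RCOSETS_def RCOSETS_def a_r_coset_def)
qed

end

theory Submission
  imports Defs
begin

text \<open>
  Everything reduces to one computation. For a permutation \<open>w\<close> of \<open>[n]\<close>, the matrix of Green's
  \<open>\<xi>\<close> with indices \<open>w(i), i\<close> has entry 1 in position \<open>(p, q)\<close> iff \<open>p = w(i)\<sigma>\<close> and \<open>q = i\<sigma>\<close> for some place
  permutation \<open>\<sigma>\<close>. Since \<open>w\<close> acts on values and \<open>\<sigma>\<close> on places, \<open>w(i)\<sigma> = w(i\<sigma>)\<close>, so the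
  condition says that \<open>q\<close> lies in the orbit of \<open>i\<close> and \<open>p = w(q)\<close>. Hence this Green operator is
  the restriction of \<open>\<Psi>(w)\<close> to one orbit (\<open>green_xi_tensor_vec\<close>): it sends \<open>v\<^sub>q\<close> to
  \<open>v\<^bsub>w(q)\<^esub>\<close> if \<open>q\<close> lies in the orbit of \<open>i\<close> and to 0 otherwise. As \<open>q\<close> lies in the
  orbit of exactly one representative, the sum over the representatives sends \<open>v\<^sub>q\<close> to
  \<open>v\<^bsub>w(q)\<^esub>\<close>, which is what \<open>\<Psi>(w)\<close> does (\<open>perm_op_eq_sum_green_xi\<close>); and the coset of \<open>w\<close>
  is identified with \<open>\<Psi>(w)\<close> (\<open>to_schur_bar\<close>).

  To compare operators on basis vectors one needs that endomorphisms of a free module of finite rank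
  are determined there (\<open>End_algebra_eq_on_basis\<close>), and to evaluate the sum on \<open>v\<^sub>q\<close> one needs that
  sums in the Schur algebra are pointwise (\<open>finsum_endo_apply\<close>). The latter presupposes that
  the Schur algebra is an additive monoid containing the summands: a sum over elements outside the
  carrier has no meaning.
\<close>

section \<open>Free modules and their linear maps\<close>

lemma free_module_simps:
  "carrier (free_module R B) = B \<rightarrow>\<^sub>E carrier R"
  "\<zero>\<^bsub>free_module R B\<^esub> = (\<lambda>b\<in>B. \<zero>\<^bsub>R\<^esub>)"
  "x \<oplus>\<^bsub>free_module R B\<^esub> y = (\<lambda>b\<in>B. x b \<oplus>\<^bsub>R\<^esub> y b)"
  "a \<odot>\<^bsub>free_module R B\<^esub> x = (\<lambda>b\<in>B. a \<otimes>\<^bsub>R\<^esub> x b)"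
  by (simp_all add: free_module_def)

lemma (in cring) module_free_module: "module R (free_module R B)"
proof (rule moduleI[OF is_cring])
  show "abelian_group (free_module R B)"
  proof (rule abelian_groupI)
    fix x assume x: "x \<in> carrier (free_module R B)"
    then have "(\<lambda>b\<in>B. \<ominus> x b) \<in> carrier (free_module R B)"
      "(\<lambda>b\<in>B. \<ominus> x b) \<oplus>\<^bsub>free_module R B\<^esub> x = \<zero>\<^bsub>free_module R B\<^esub>"
      by (auto simp: free_module_simps PiE_iff l_neg intro!: restrict_ext)
    then show "\<exists>y\<in>carrier (free_module R B). y \<oplus>\<^bsub>free_module R B\<^esub> x = \<zero>\<^bsub>free_module R B\<^esub>"
      by blast
  qed (auto simp: free_module_simps PiE_iff a_ac fun_eq_iff extensional_def)
qed (auto simp: free_module_simps PiE_iff m_assoc l_distr r_distr fun_eq_iff extensional_def)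

lemma (in cring) basis_vec_closed: "basis_vec R B b \<in> carrier (free_module R B)"
  by (auto simp: basis_vec_def free_module_simps)

lemma (in cring) finsum_free_module_apply:
  assumes "finite I" "g \<in> I \<rightarrow> carrier (free_module R B)" "c \<in> B"
  shows "(\<Oplus>\<^bsub>free_module R B\<^esub>i\<in>I. g i) c = (\<Oplus>i\<in>I. g i c)"
proof -
  interpret F: module R "free_module R B" by (rule module_free_module)
  show ?thesis using assms(1,2)
  proof (induction I rule: finite_induct)
    case empty
    then show ?case using assms(3) by (simp add: free_module_simps(2))
  next
    case (insert i I)
    have "g i \<in> carrier (free_module R B)" "g \<in> I \<rightarrow> carrier (free_module R B)"
      "(\<lambda>i. g i c) \<in> I \<rightarrow> carrier R" "g i c \<in> carrier R"
      using insert.prems assms(3) by (auto simp: free_module_simps Pi_def PiE_iff)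
    then show ?case using insert.hyps insert.IH assms(3)
      by (simp add: F.finsum_insert finsum_insert free_module_simps(3))
  qed
qed

lemma (in cring) free_module_basis_expansion:
  assumes "finite B" and x: "x \<in> carrier (free_module R B)"
  shows "(\<Oplus>\<^bsub>free_module R B\<^esub>b\<in>B. x b \<odot>\<^bsub>free_module R B\<^esub> basis_vec R B b) = x"
proof -
  interpret F: module R "free_module R B" by (rule module_free_module)
  have mem: "x b \<in> carrier R" if "b \<in> B" for b
    using x that by (auto simp: free_module_simps)
  have clo: "(\<lambda>b. x b \<odot>\<^bsub>free_module R B\<^esub> basis_vec R B b) \<in> B \<rightarrow> carrier (free_module R B)"
    using mem by (auto simp: basis_vec_closed)
  show ?thesis
  proof (rule PiE_ext[where k = B])
    show "(\<Oplus>\<^bsub>free_module R B\<^esub>b\<in>B. x b \<odot>\<^bsub>free_module R B\<^esub> basis_vec R B b) \<in> B \<rightarrow>\<^sub>E carrier R"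
      using F.finsum_closed[OF clo] by (simp only: free_module_simps)
    show "x \<in> B \<rightarrow>\<^sub>E carrier R" using x by (simp only: free_module_simps)
    fix c assume c: "c \<in> B"
    have "(\<Oplus>\<^bsub>free_module R B\<^esub>b\<in>B. x b \<odot>\<^bsub>free_module R B\<^esub> basis_vec R B b) c
        = (\<Oplus>b\<in>B. (x b \<odot>\<^bsub>free_module R B\<^esub> basis_vec R B b) c)"
      by (rule finsum_free_module_apply[OF \<open>finite B\<close> clo c])
    also have "\<dots> = (\<Oplus>b\<in>B. if c = b then x b else \<zero>)"
      using mem c by (intro finsum_cong') (auto simp: free_module_simps basis_vec_def)
    also have "\<dots> = x c"
      using mem by (intro finsum_singleton) (auto simp: c \<open>finite B\<close>)
    finally show "(\<Oplus>\<^bsub>free_module R B\<^esub>b\<in>B. x b \<odot>\<^bsub>free_module R B\<^esub> basis_vec R B b) c = x c" .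
  qed
qed

context module
begin

lemma lin_ext_closed:
  assumes "finite B" "f \<in> B \<rightarrow> carrier M" "x \<in> carrier (free_module R B)"
  shows "lin_ext R B M f x \<in> carrier M"
  using assms by (auto simp: lin_ext_def free_module_simps Pi_def PiE_iff intro!: M.finsum_closed)

lemma lin_ext_add:
  assumes "finite B" "f \<in> B \<rightarrow> carrier M"
    "x \<in> carrier (free_module R B)" "y \<in> carrier (free_module R B)"
  shows "lin_ext R B M f (x \<oplus>\<^bsub>free_module R B\<^esub> y) = lin_ext R B M f x \<oplus>\<^bsub>M\<^esub> lin_ext R B M f y"
proof -
  interpret F: module R "free_module R B" by (rule module_free_module)
  have mem: "x b \<in> carrier R" "y b \<in> carrier R" "f b \<in> carrier M" if "b \<in> B" for b
    using assms that by (auto simp: free_module_simps)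
  have "lin_ext R B M f (x \<oplus>\<^bsub>free_module R B\<^esub> y)
      = (\<Oplus>\<^bsub>M\<^esub>b\<in>B. (x \<oplus>\<^bsub>free_module R B\<^esub> y) b \<odot>\<^bsub>M\<^esub> f b)"
    using assms by (simp add: lin_ext_def)
  also have "\<dots> = (\<Oplus>\<^bsub>M\<^esub>b\<in>B. x b \<odot>\<^bsub>M\<^esub> f b \<oplus>\<^bsub>M\<^esub> y b \<odot>\<^bsub>M\<^esub> f b)"
    using mem by (intro M.finsum_cong') (auto simp: free_module_simps smult_l_distr)
  also have "\<dots> = lin_ext R B M f x \<oplus>\<^bsub>M\<^esub> lin_ext R B M f y"
    using mem assms by (subst M.finsum_addf) (auto simp: lin_ext_def)
  finally show ?thesis .
qed

lemma lin_ext_smult: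
  assumes "finite B" "f \<in> B \<rightarrow> carrier M" "a \<in> carrier R" "x \<in> carrier (free_module R B)"
  shows "lin_ext R B M f (a \<odot>\<^bsub>free_module R B\<^esub> x) = a \<odot>\<^bsub>M\<^esub> lin_ext R B M f x"
proof -
  interpret F: module R "free_module R B" by (rule module_free_module)
  have mem: "x b \<in> carrier R" "f b \<in> carrier M" if "b \<in> B" for b
    using assms that by (auto simp: free_module_simps)
  have "lin_ext R B M f (a \<odot>\<^bsub>free_module R B\<^esub> x)
      = (\<Oplus>\<^bsub>M\<^esub>b\<in>B. (a \<odot>\<^bsub>free_module R B\<^esub> x) b \<odot>\<^bsub>M\<^esub> f b)"
    using assms by (simp add: lin_ext_def)
  also have "\<dots> = (\<Oplus>\<^bsub>M\<^esub>b\<in>B. a \<odot>\<^bsub>M\<^esub> (x b \<odot>\<^bsub>M\<^esub> f b))"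
    using mem assms by (intro M.finsum_cong') (auto simp: free_module_simps smult_assoc1)
  also have "\<dots> = a \<odot>\<^bsub>M\<^esub> lin_ext R B M f x"
    using mem assms by (subst finsum_smult_ldistr[symmetric]) (auto simp: lin_ext_def)
  finally show ?thesis .
qed

lemma lin_ext_basis_vec:
  assumes "finite B" "f \<in> B \<rightarrow> carrier M" "b \<in> B"
  shows "lin_ext R B M f (basis_vec R B b) = f b"
proof -
  have mem: "f c \<in> carrier M" if "c \<in> B" for c
    using assms that by auto
  have "lin_ext R B M f (basis_vec R B b) = (\<Oplus>\<^bsub>M\<^esub>c\<in>B. basis_vec R B b c \<odot>\<^bsub>M\<^esub> f c)"
    by (simp add: lin_ext_def basis_vec_closed)
  also have "\<dots> = (\<Oplus>\<^bsub>M\<^esub>c\<in>B. if b = c then f c else \<zero>\<^bsub>M\<^esub>)"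
    using mem by (intro M.finsum_cong') (auto simp: basis_vec_def)
  also have "\<dots> = f b"
    using assms by (intro M.finsum_singleton) auto
  finally show ?thesis .
qed

end


section \<open>Modules of endomorphisms\<close>

lemma End_algebra_simps:
  "f \<in> carrier (End_algebra R M) \<longleftrightarrow> f \<in> carrier M \<rightarrow>\<^sub>E carrier M \<and>
        (\<forall>x\<in>carrier M. \<forall>y\<in>carrier M. f (x \<oplus>\<^bsub>M\<^esub> y) = f x \<oplus>\<^bsub>M\<^esub> f y) \<and>
        (\<forall>a\<in>carrier R. \<forall>x\<in>carrier M. f (a \<odot>\<^bsub>M\<^esub> x) = a \<odot>\<^bsub>M\<^esub> f x)"
  "\<zero>\<^bsub>End_algebra R M\<^esub> = (\<lambda>x\<in>carrier M. \<zero>\<^bsub>M\<^esub>)"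
  "f \<oplus>\<^bsub>End_algebra R M\<^esub> g = (\<lambda>x\<in>carrier M. f x \<oplus>\<^bsub>M\<^esub> g x)"
  "a \<odot>\<^bsub>End_algebra R M\<^esub> f = (\<lambda>x\<in>carrier M. a \<odot>\<^bsub>M\<^esub> f x)"
  by (simp_all add: End_algebra_def)

context module
begin

lemma End_algebra_apply:
  assumes "f \<in> carrier (End_algebra R M)"
  shows "x \<in> carrier M \<Longrightarrow> f x \<in> carrier M"
    and "x \<in> carrier M \<Longrightarrow> y \<in> carrier M \<Longrightarrow> f (x \<oplus>\<^bsub>M\<^esub> y) = f x \<oplus>\<^bsub>M\<^esub> f y"
    and "a \<in> carrier R \<Longrightarrow> x \<in> carrier M \<Longrightarrow> f (a \<odot>\<^bsub>M\<^esub> x) = a \<odot>\<^bsub>M\<^esub> f x"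
  using assms by (auto simp: End_algebra_simps)

lemma End_algebra_zero:
  assumes "f \<in> carrier (End_algebra R M)"
  shows "f \<zero>\<^bsub>M\<^esub> = \<zero>\<^bsub>M\<^esub>"
  using End_algebra_apply(3)[OF assms, of \<zero> "\<zero>\<^bsub>M\<^esub>"] End_algebra_apply(1)[OF assms] by simp

lemma End_algebra_ext:
  assumes "f \<in> carrier (End_algebra R M)" "g \<in> carrier (End_algebra R M)"
    and "\<And>x. x \<in> carrier M \<Longrightarrow> f x = g x"
  shows "f = g"
  using assms by (auto simp: End_algebra_simps intro!: PiE_ext[where k = "carrier M"])

lemma End_algebra_compose:
  assumes "f \<in> carrier (End_algebra R M)" "g \<in> carrier (End_algebra R M)"
  shows "compose (carrier M) f g \<in> carrier (End_algebra R M)"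
  using assms by (auto simp: End_algebra_simps compose_def PiE_iff)

lemma End_algebra_finsum:
  assumes f: "f \<in> carrier (End_algebra R M)" and "finite I" "g \<in> I \<rightarrow> carrier M"
  shows "f (\<Oplus>\<^bsub>M\<^esub>i\<in>I. g i) = (\<Oplus>\<^bsub>M\<^esub>i\<in>I. f (g i))"
  using assms(2,3)
proof (induction I rule: finite_induct)
  case empty
  then show ?case by (simp add: End_algebra_zero[OF f])
next
  case (insert i I)
  then have "g i \<in> carrier M" "g \<in> I \<rightarrow> carrier M" "(\<lambda>i. f (g i)) \<in> I \<rightarrow> carrier M"
    "f (g i) \<in> carrier M"
    using End_algebra_apply(1)[OF f] by auto
  then show ?case using insert.hyps insert.IH
    by (simp add: M.finsum_insert End_algebra_apply(2)[OF f])
qed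

lemma End_algebra_add_closed:
  assumes f: "f \<in> carrier (End_algebra R M)" and g: "g \<in> carrier (End_algebra R M)"
  shows "f \<oplus>\<^bsub>End_algebra R M\<^esub> g \<in> carrier (End_algebra R M)"
  using End_algebra_apply[OF f] End_algebra_apply[OF g]
  by (auto simp: End_algebra_simps smult_r_distr M.a_ac)

lemma End_algebra_smult_closed:
  assumes a: "a \<in> carrier R" and f: "f \<in> carrier (End_algebra R M)"
  shows "a \<odot>\<^bsub>End_algebra R M\<^esub> f \<in> carrier (End_algebra R M)"
  using End_algebra_apply[OF f] a
  by (auto simp: End_algebra_simps smult_r_distr smult_assoc1[symmetric] m_comm)

lemma module_End_algebra: "module R (End_algebra R M)"
proof (rule moduleI[OF is_cring])
  let ?E = "End_algebra R M"
  have zero: "\<zero>\<^bsub>?E\<^esub> \<in> carrier ?E"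
    by (auto simp: End_algebra_simps)
  show "abelian_group ?E"
  proof (rule abelian_groupI)
    fix f assume f: "f \<in> carrier ?E"
    \<comment> \<open>Scaling by \<open>-1\<close> gives an additive inverse whose linearity is already known.\<close>
    have "(\<ominus> \<one>) \<odot>\<^bsub>?E\<^esub> f \<in> carrier ?E"
      by (rule End_algebra_smult_closed[OF _ f]) simp
    moreover have "(\<ominus> \<one>) \<odot>\<^bsub>?E\<^esub> f \<oplus>\<^bsub>?E\<^esub> f = \<zero>\<^bsub>?E\<^esub>"
      using End_algebra_apply[OF f]
      by (auto simp: End_algebra_simps smult_l_minus M.l_neg intro!: restrict_ext)
    ultimately show "\<exists>g\<in>carrier ?E. g \<oplus>\<^bsub>?E\<^esub> f = \<zero>\<^bsub>?E\<^esub>" by blast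
  next
    fix f g h assume "f \<in> carrier ?E" "g \<in> carrier ?E" "h \<in> carrier ?E"
    note fgh = this[THEN End_algebra_apply(1)]
    show "f \<oplus>\<^bsub>?E\<^esub> g \<oplus>\<^bsub>?E\<^esub> h = f \<oplus>\<^bsub>?E\<^esub> (g \<oplus>\<^bsub>?E\<^esub> h)"
      unfolding End_algebra_simps(3) by (rule restrict_ext) (simp add: fgh M.a_assoc)
  next
    fix f g assume "f \<in> carrier ?E" "g \<in> carrier ?E"
    note fg = this[THEN End_algebra_apply(1)]
    show "f \<oplus>\<^bsub>?E\<^esub> g = g \<oplus>\<^bsub>?E\<^esub> f"
      unfolding End_algebra_simps(3) by (rule restrict_ext) (simp add: fg M.a_comm)
  next
    fix f assume f: "f \<in> carrier ?E"
    show "\<zero>\<^bsub>?E\<^esub> \<oplus>\<^bsub>?E\<^esub> f = f"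
      using f by (auto simp: End_algebra_simps PiE_iff fun_eq_iff extensional_def)
  qed (use End_algebra_add_closed zero in auto)
next
  fix f assume f: "f \<in> carrier (End_algebra R M)"
  show "\<one> \<odot>\<^bsub>End_algebra R M\<^esub> f = f"
    using f by (auto simp: End_algebra_simps PiE_iff fun_eq_iff extensional_def)
next
  fix a f g assume "a \<in> carrier R" "f \<in> carrier (End_algebra R M)" "g \<in> carrier (End_algebra R M)"
  then show "a \<odot>\<^bsub>End_algebra R M\<^esub> (f \<oplus>\<^bsub>End_algebra R M\<^esub> g) =
      a \<odot>\<^bsub>End_algebra R M\<^esub> f \<oplus>\<^bsub>End_algebra R M\<^esub> a \<odot>\<^bsub>End_algebra R M\<^esub> g"
    unfolding End_algebra_simps(3,4)
    by (intro restrict_ext) (simp add: End_algebra_apply(1) smult_r_distr)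
next
  fix a b f
  assume ab: "a \<in> carrier R" "b \<in> carrier R" and f: "f \<in> carrier (End_algebra R M)"
  note f = End_algebra_apply(1)[OF f]
  show "(a \<oplus> b) \<odot>\<^bsub>End_algebra R M\<^esub> f =
      a \<odot>\<^bsub>End_algebra R M\<^esub> f \<oplus>\<^bsub>End_algebra R M\<^esub> b \<odot>\<^bsub>End_algebra R M\<^esub> f"
    unfolding End_algebra_simps(3,4)
    by (rule restrict_ext) (simp add: ab f smult_l_distr)
  show "(a \<otimes> b) \<odot>\<^bsub>End_algebra R M\<^esub> f =
      a \<odot>\<^bsub>End_algebra R M\<^esub> (b \<odot>\<^bsub>End_algebra R M\<^esub> f)"
    unfolding End_algebra_simps(4)
    by (rule restrict_ext) (simp only: restrict_apply' smult_assoc1[OF ab f])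
qed (rule End_algebra_smult_closed)

text \<open>Stated for any additive monoid of endomorphisms with the pointwise operations, because a sum
  is taken with respect to the carrier of its structure: a sum in the Schur algebra is not by
  definition a sum in the full endomorphism algebra.\<close>

lemma finsum_endo_apply:
  fixes S (structure)
  assumes S: "abelian_monoid S" "carrier S \<subseteq> carrier (End_algebra R M)"
      "add S = add (End_algebra R M)" "zero S = zero (End_algebra R M)"
    and "finite I" "g \<in> I \<rightarrow> carrier S" and x: "x \<in> carrier M"
  shows "(\<Oplus>\<^bsub>S\<^esub>i\<in>I. g i) x = (\<Oplus>\<^bsub>M\<^esub>i\<in>I. g i x)"
proof -
  interpret S: abelian_monoid S by fact
  show ?thesis using assms(5,6)
  proof (induction I rule: finite_induct)
    case empty
    then show ?case using x S(4) by (simp add: End_algebra_simps)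
  next
    case (insert i I)
    then have "g i \<in> carrier S" "g \<in> I \<rightarrow> carrier S" "(\<lambda>i. g i x) \<in> I \<rightarrow> carrier M"
      "g i x \<in> carrier M"
      using End_algebra_apply(1)[OF _ x] S(2) by auto
    then show ?case using insert.hyps insert.IH x
      by (simp add: M.finsum_insert S.finsum_insert S(3) End_algebra_simps(3))
  qed
qed

end

context cring
begin

lemma lin_ext_in_End_algebra:
  assumes "finite B" "f \<in> B \<rightarrow> carrier (free_module R B)"
  shows "lin_ext R B (free_module R B) f \<in> carrier (End_algebra R (free_module R B))"
proof -
  interpret F: module R "free_module R B" by (rule module_free_module)
  show ?thesis
    unfolding End_algebra_simps
    using F.lin_ext_closed[OF assms] F.lin_ext_add[OF assms] F.lin_ext_smult[OF assms]
    by (auto simp: lin_ext_def)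
qed

text \<open>Expand the argument in the basis and use linearity of both maps.\<close>

lemma End_algebra_eq_on_basis:
  assumes "finite B"
    and f: "f \<in> carrier (End_algebra R (free_module R B))"
    and g: "g \<in> carrier (End_algebra R (free_module R B))"
    and eq: "\<And>b. b \<in> B \<Longrightarrow> f (basis_vec R B b) = g (basis_vec R B b)"
  shows "f = g"
proof -
  interpret F: module R "free_module R B" by (rule module_free_module)
  show ?thesis
  proof (rule F.End_algebra_ext[OF f g])
    fix x assume x: "x \<in> carrier (free_module R B)"
    have mem: "x b \<in> carrier R" if "b \<in> B" for b
      using x that by (auto simp: free_module_simps)
    have expand: "h x = (\<Oplus>\<^bsub>free_module R B\<^esub>b\<in>B. x b \<odot>\<^bsub>free_module R B\<^esub> h (basis_vec R B b))"
      if h: "h \<in> carrier (End_algebra R (free_module R B))" for h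
    proof -
      have "h x = h (\<Oplus>\<^bsub>free_module R B\<^esub>b\<in>B. x b \<odot>\<^bsub>free_module R B\<^esub> basis_vec R B b)"
        by (simp only: free_module_basis_expansion[OF \<open>finite B\<close> x])
      also have "\<dots> = (\<Oplus>\<^bsub>free_module R B\<^esub>b\<in>B. h (x b \<odot>\<^bsub>free_module R B\<^esub> basis_vec R B b))"
        using mem by (intro F.End_algebra_finsum[OF h \<open>finite B\<close>]) (auto simp: basis_vec_closed)
      also have "\<dots> = (\<Oplus>\<^bsub>free_module R B\<^esub>b\<in>B. x b \<odot>\<^bsub>free_module R B\<^esub> h (basis_vec R B b))"
        using mem F.End_algebra_apply[OF h]
          by (intro F.finsum_cong') (auto simp: basis_vec_closed)
      finally show ?thesis .
    qed
    show "f x = g x"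
      unfolding expand[OF f] expand[OF g]
      using mem eq F.End_algebra_apply(1)[OF g]
      by (intro F.finsum_cong') (auto simp: basis_vec_closed)
  qed
qed

end


section \<open>Place permutations and value permutations\<close>

lemma finite_multi_index: "finite (multi_index n r)"
  by (simp add: multi_index_def finite_PiE)

lemma sym_group_image:
  "\<sigma> \<in> carrier (sym_group m) \<Longrightarrow> k \<in> {1..m} \<Longrightarrow> \<sigma> k \<in> {1..m}"
  unfolding sym_group_carrier by (simp only: permutes_in_image)

lemma place_act_closed:
  assumes "\<sigma> \<in> carrier (sym_group r)" "i \<in> multi_index n r"
  shows "place_act r \<sigma> i \<in> multi_index n r"
  unfolding multi_index_def place_act_def restrict_PiE_iff
  using assms(2) sym_group_image[OF assms(1)] unfolding multi_index_def by blast

lemma value_act_closed: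
  assumes "w \<in> carrier (sym_group n)" "i \<in> multi_index n r"
  shows "value_act r w i \<in> multi_index n r"
  unfolding multi_index_def value_act_def restrict_PiE_iff
  using assms(2) sym_group_image[OF assms(1)] unfolding multi_index_def by blast

text \<open>Permuting values commutes with permuting places; this is why the image of \<open>\<Psi>\<close> lies in the
  Schur algebra.\<close>

lemma place_act_value_act:
  assumes "\<sigma> \<in> carrier (sym_group r)"
  shows "place_act r \<sigma> (value_act r w i) = value_act r w (place_act r \<sigma> i)"
  unfolding value_act_def place_act_def
  by (rule restrict_ext) (simp only: restrict_apply' sym_group_image[OF assms])

text \<open>A right action, hence the order of the composition.\<close>

lemma place_act_comp:
  assumes "\<tau> \<in> carrier (sym_group r)"
  shows "place_act r \<tau> (place_act r \<sigma> i) = place_act r (\<sigma> \<circ> \<tau>) i"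
  unfolding place_act_def
  by (rule restrict_ext) (simp only: restrict_apply' sym_group_image[OF assms] comp_apply)

lemma place_act_id: "i \<in> multi_index n r \<Longrightarrow> place_act r id i = i"
  by (auto simp: place_act_def multi_index_def PiE_def extensional_restrict)

abbreviation place_orbit :: "nat \<Rightarrow> (nat \<Rightarrow> nat) \<Rightarrow> (nat \<Rightarrow> nat) set"
  where "place_orbit r \<equiv> orbit (sym_group r) (place_act r)"

lemma mem_place_orbit:
  "q \<in> place_orbit r i \<longleftrightarrow> (\<exists>\<sigma>\<in>carrier (sym_group r). q = place_act r \<sigma> i)"
  by (auto simp: orbit_def)

lemma place_act_mem_place_orbit:
  assumes "\<sigma> \<in> carrier (sym_group r)" "q \<in> place_orbit r i"
  shows "place_act r \<sigma> q \<in> place_orbit r i"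
proof -
  obtain \<tau> where \<tau>: "\<tau> \<in> carrier (sym_group r)" "q = place_act r \<tau> i"
    using assms(2) by (auto simp: mem_place_orbit)
  have "\<tau> \<circ> \<sigma> \<in> carrier (sym_group r)"
    using assms(1) \<tau>(1) by (simp add: sym_group_carrier permutes_compose)
  moreover have "place_act r \<sigma> q = place_act r (\<tau> \<circ> \<sigma>) i"
    unfolding \<tau>(2) by (rule place_act_comp[OF assms(1)])
  ultimately show ?thesis
    unfolding mem_place_orbit by blast
qed

lemma place_orbit_sym:
  assumes "i \<in> multi_index n r" "q \<in> place_orbit r i"
  shows "i \<in> place_orbit r q"
proof -
  obtain \<sigma> where \<sigma>: "\<sigma> permutes {1..r}" "q = place_act r \<sigma> i"
    using assms by (auto simp: mem_place_orbit sym_group_carrier)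
  then have "place_act r (inv' \<sigma>) q = place_act r (\<sigma> \<circ> inv' \<sigma>) i"
    by (simp add: place_act_comp sym_group_carrier permutes_inv)
  also have "\<dots> = i"
    using \<sigma> assms by (simp add: permutes_inv_o place_act_id)
  finally show ?thesis
    using permutes_inv[OF \<sigma>(1)] by (force simp: mem_place_orbit sym_group_carrier)
qed

lemma place_act_mem_place_orbit_iff:
  assumes "\<sigma> \<in> carrier (sym_group r)" "q \<in> multi_index n r"
  shows "place_act r \<sigma> q \<in> place_orbit r i \<longleftrightarrow> q \<in> place_orbit r i"
proof
  assume orb: "place_act r \<sigma> q \<in> place_orbit r i"
  have "q \<in> place_orbit r (place_act r \<sigma> q)"
    using assms by (intro place_orbit_sym[OF assms(2)]) (auto simp: mem_place_orbit)
  then obtain \<tau> where "\<tau> \<in> carrier (sym_group r)" "q = place_act r \<tau> (place_act r \<sigma> q)"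
    by (auto simp: mem_place_orbit)
  then show "q \<in> place_orbit r i"
    using place_act_mem_place_orbit[OF _ orb] by metis
next
  assume "q \<in> place_orbit r i"
  then show "place_act r \<sigma> q \<in> place_orbit r i"
    by (rule place_act_mem_place_orbit[OF assms(1)])
qed


text \<open>The representative of the orbit of \<open>q\<close> is found by looking for elements of the orbit of
  \<open>q\<close>, whereas Green's matrices ask whether \<open>q\<close> lies in the orbit of a representative. Symmetry of
  the orbit relation makes the two agree.\<close>

lemma place_orbit_representative:
  assumes Orb: "Orb \<subseteq> multi_index n r"
    and rep: "\<forall>X\<in>place_orbits n r. \<exists>!i. i \<in> Orb \<inter> X"
    and q: "q \<in> multi_index n r"
  obtains i0 where "i0 \<in> Orb" "\<And>i. i \<in> Orb \<Longrightarrow> q \<in> place_orbit r i \<longleftrightarrow> i0 = i"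
proof -
  have "place_orbit r q \<in> place_orbits n r"
    using q by (auto simp: place_orbits_def orbits_def)
  with rep have "\<exists>!i. i \<in> Orb \<inter> place_orbit r q"
    by (rule bspec)
  then obtain i0 where i0: "i0 \<in> Orb \<inter> place_orbit r q"
    and uniq: "\<forall>i. i \<in> Orb \<inter> place_orbit r q \<longrightarrow> i = i0"
    by (rule ex1E)
  show thesis
  proof (rule that)
    show "i0 \<in> Orb" using i0 by (rule IntD1)
    fix i assume i: "i \<in> Orb"
    show "q \<in> place_orbit r i \<longleftrightarrow> i0 = i"
    proof
      assume "q \<in> place_orbit r i"
      then have "i \<in> place_orbit r q"
        using place_orbit_sym[of i n r q] i Orb by blast
      with i have "i \<in> Orb \<inter> place_orbit r q" by (rule IntI)
      then show "i0 = i" by (rule uniq[THEN spec, THEN mp, symmetric])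
    next
      assume "i0 = i"
      with i0 show "q \<in> place_orbit r i"
        using place_orbit_sym[OF q, of i0] by (simp only: Int_iff)
    qed
  qed
qed


section \<open>Operators on tensor space\<close>

context cring
begin

lemma module_tensor_power: "module R (tensor_power R n r)"
  unfolding tensor_power_def by (rule module_free_module)

lemma tensor_vec_closed:
  "j \<in> multi_index n r \<Longrightarrow> tensor_vec R n r j \<in> carrier (tensor_power R n r)"
  by (simp add: tensor_vec_eq_basis_vec is_cring basis_vec_closed tensor_power_def)

lemma tensor_op_closed:
  assumes "f \<in> multi_index n r \<rightarrow> carrier (tensor_power R n r)"
  shows "tensor_op R n r f \<in> carrier (End_algebra R (tensor_power R n r))"
  using assms unfolding tensor_power_def
  by (intro lin_ext_in_End_algebra finite_multi_index)

lemma tensor_op_tensor_vec: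
  assumes "f \<in> multi_index n r \<rightarrow> carrier (tensor_power R n r)" "j \<in> multi_index n r"
  shows "tensor_op R n r f (tensor_vec R n r j) = f j"
  using module.lin_ext_basis_vec[OF module_tensor_power finite_multi_index assms] assms
  by (simp add: tensor_vec_eq_basis_vec is_cring)

lemma tensor_endo_eqI:
  assumes "f \<in> carrier (End_algebra R (tensor_power R n r))"
    and "g \<in> carrier (End_algebra R (tensor_power R n r))"
    and "\<And>j. j \<in> multi_index n r \<Longrightarrow> f (tensor_vec R n r j) = g (tensor_vec R n r j)"
  shows "f = g"
  using assms End_algebra_eq_on_basis[OF finite_multi_index, of f n r g]
  by (simp add: tensor_vec_eq_basis_vec is_cring tensor_power_def)

lemma place_op_closed:
  "\<sigma> \<in> carrier (sym_group r) \<Longrightarrow> place_op R n r \<sigma> \<in> carrier (End_algebra R (tensor_power R n r))"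
  unfolding place_op_def by (intro tensor_op_closed) (simp add: tensor_vec_closed place_act_closed)

lemma place_op_tensor_vec:
  "\<sigma> \<in> carrier (sym_group r) \<Longrightarrow> j \<in> multi_index n r \<Longrightarrow>
    place_op R n r \<sigma> (tensor_vec R n r j) = tensor_vec R n r (place_act r \<sigma> j)"
  unfolding place_op_def
  by (intro tensor_op_tensor_vec) (simp_all add: tensor_vec_closed place_act_closed)

lemma perm_op_closed:
  "w \<in> carrier (sym_group n) \<Longrightarrow> perm_op R n r w \<in> carrier (End_algebra R (tensor_power R n r))"
  unfolding perm_op_def by (intro tensor_op_closed) (simp add: tensor_vec_closed value_act_closed)

lemma perm_op_tensor_vec:
  "w \<in> carrier (sym_group n) \<Longrightarrow> j \<in> multi_index n r \<Longrightarrow>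
    perm_op R n r w (tensor_vec R n r j) = tensor_vec R n r (value_act r w j)"
  unfolding perm_op_def
  by (intro tensor_op_tensor_vec) (simp_all add: tensor_vec_closed value_act_closed)

lemma green_xi_closed: "green_xi R n r i j \<in> carrier (End_algebra R (tensor_power R n r))"
  unfolding green_xi_def
  by (intro tensor_op_closed) (auto simp: tensor_power_def free_module_simps)

text \<open>The key computation: because the two actions commute, a simultaneous place permutation of
  \<open>w(i)\<close> and \<open>i\<close> that turns \<open>i\<close> into \<open>q\<close> must turn \<open>w(i)\<close> into \<open>w(q)\<close>. So column \<open>q\<close> has at
  most one nonzero entry.\<close>

lemma green_xi_tensor_vec:
  assumes w: "w \<in> carrier (sym_group n)" and q: "q \<in> multi_index n r"
  shows "green_xi R n r (value_act r w i) i (tensor_vec R n r q) =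
    (if q \<in> place_orbit r i then tensor_vec R n r (value_act r w q)
     else \<zero>\<^bsub>tensor_power R n r\<^esub>)"
proof -
  have iff: "(\<exists>\<sigma>\<in>carrier (sym_group r).
        (p, q) = (place_act r \<sigma> (value_act r w i), place_act r \<sigma> i)) \<longleftrightarrow>
      q \<in> place_orbit r i \<and> p = value_act r w q" for p
    by (auto simp: mem_place_orbit place_act_value_act)
  have "green_xi R n r (value_act r w i) i (tensor_vec R n r q) =
      (\<lambda>p\<in>multi_index n r. if q \<in> place_orbit r i \<and> p = value_act r w q then \<one> else \<zero>)"
    unfolding green_xi_def using q
    by (subst tensor_op_tensor_vec)
      (auto simp: tensor_power_def free_module_simps iff[unfolded prod.inject] cong: if_cong)
  also have "\<dots> = (if q \<in> place_orbit r i then tensor_vec R n r (value_act r w q)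
      else \<zero>\<^bsub>tensor_power R n r\<^esub>)"
    using value_act_closed[OF w q]
    by (auto simp: tensor_vec_eq_basis_vec is_cring basis_vec_def tensor_power_def
      free_module_simps)
  finally show ?thesis .
qed


section \<open>The Schur algebra\<close>

lemma schur_algebra_simps:
  "f \<in> carrier (schur_algebra R n r) \<longleftrightarrow> f \<in> carrier (End_algebra R (tensor_power R n r)) \<and>
    (\<forall>\<sigma>\<in>carrier (sym_group r). \<forall>x\<in>carrier (tensor_power R n r).
      f (place_op R n r \<sigma> x) = place_op R n r \<sigma> (f x))"
  "add (schur_algebra R n r) = add (End_algebra R (tensor_power R n r))"
  "zero (schur_algebra R n r) = zero (End_algebra R (tensor_power R n r))"
  by (simp_all add: schur_algebra_def)

lemma abelian_monoid_schur_algebra: "abelian_monoid (schur_algebra R n r)"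
proof -
  interpret T: module R "tensor_power R n r" by (rule module_tensor_power)
  interpret E: module R "End_algebra R (tensor_power R n r)" by (rule T.module_End_algebra)
  show ?thesis
  proof (rule abelian_monoidI)
    fix f g
    assume f: "f \<in> carrier (schur_algebra R n r)" and g: "g \<in> carrier (schur_algebra R n r)"
    have "(f \<oplus>\<^bsub>End_algebra R (tensor_power R n r)\<^esub> g) (place_op R n r \<sigma> x) =
        place_op R n r \<sigma> ((f \<oplus>\<^bsub>End_algebra R (tensor_power R n r)\<^esub> g) x)"
      if \<sigma>: "\<sigma> \<in> carrier (sym_group r)" and x: "x \<in> carrier (tensor_power R n r)" for \<sigma> x
      using f g \<sigma> x T.End_algebra_apply[OF place_op_closed[OF \<sigma>]]
      by (simp add: schur_algebra_simps End_algebra_simps(3) T.End_algebra_apply(1))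
    then show "f \<oplus>\<^bsub>schur_algebra R n r\<^esub> g \<in> carrier (schur_algebra R n r)"
      using f g by (simp add: schur_algebra_simps)
  next
    show "\<zero>\<^bsub>schur_algebra R n r\<^esub> \<in> carrier (schur_algebra R n r)"
      unfolding schur_algebra_simps
      using T.End_algebra_apply(1)[OF place_op_closed] T.End_algebra_zero[OF place_op_closed]
      by (simp add: End_algebra_simps(2)[of R "tensor_power R n r", symmetric])
        (simp add: End_algebra_simps(2))
  qed (simp_all add: schur_algebra_simps E.a_ac)
qed

text \<open>On \<open>v\<^sub>q\<close>, applying \<open>\<sigma>\<close> before or after the Green operator gives \<open>v\<close> with index
  \<open>w(q\<sigma>) = w(q)\<sigma>\<close>, or 0 both times, since \<open>q\<close> and \<open>q\<sigma>\<close> lie in the same orbits.\<close>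

lemma green_xi_in_schur_algebra:
  assumes w: "w \<in> carrier (sym_group n)"
  shows "green_xi R n r (value_act r w i) i \<in> carrier (schur_algebra R n r)"
proof -
  interpret T: module R "tensor_power R n r" by (rule module_tensor_power)
  let ?V = "carrier (tensor_power R n r)" and ?xi = "green_xi R n r (value_act r w i) i"
  have comm: "compose ?V ?xi (place_op R n r \<sigma>) = compose ?V (place_op R n r \<sigma>) ?xi"
    if \<sigma>: "\<sigma> \<in> carrier (sym_group r)" for \<sigma>
  proof (rule tensor_endo_eqI)
    fix q assume q: "q \<in> multi_index n r"
    show "compose ?V ?xi (place_op R n r \<sigma>) (tensor_vec R n r q) =
        compose ?V (place_op R n r \<sigma>) ?xi (tensor_vec R n r q)"
      using w \<sigma> q
      by (simp add: compose_def tensor_vec_closed place_op_tensor_vec green_xi_tensor_vec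
        place_act_closed value_act_closed place_act_mem_place_orbit_iff place_act_value_act
        T.End_algebra_zero[OF place_op_closed])
  qed (simp_all add: T.End_algebra_compose green_xi_closed place_op_closed \<sigma>)
  have "?xi (place_op R n r \<sigma> x) = place_op R n r \<sigma> (?xi x)"
    if \<sigma>: "\<sigma> \<in> carrier (sym_group r)" and x: "x \<in> ?V" for \<sigma> x
    using fun_cong[OF comm[OF \<sigma>], of x] by (simp only: compose_eq[OF x])
  then show ?thesis
    by (simp add: schur_algebra_simps green_xi_closed)
qed

text \<open>Additivity of \<open>\<Psi>\<close> makes it constant on the coset, with value \<open>\<Psi>(w)\<close>. The coset is
  nonempty because the kernel contains 0, so its image is a singleton and \<^const>\<open>the_elem\<close>
  returns that value.\<close>

lemma to_schur_bar:
  assumes w: "w \<in> carrier (sym_group n)"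
  shows "to_schur R n r (bar R n r w) = perm_op R n r w"
proof -
  interpret T: module R "tensor_power R n r" by (rule module_tensor_power)
  interpret E: module R "End_algebra R (tensor_power R n r)" by (rule T.module_End_algebra)
  let ?W = "carrier (sym_group n)"
  let ?F = "free_module R ?W" and ?e = "basis_vec R ?W w"
  interpret F: module R ?F by (rule module_free_module)
  have fin: "finite ?W"
    by (simp add: sym_group_def finite_permutations)
  have op: "perm_op R n r \<in> ?W \<rightarrow> carrier (End_algebra R (tensor_power R n r))"
    by (simp add: perm_op_closed)
  have ga: "carrier (group_algebra R (sym_group n)) = carrier ?F"
    "add (group_algebra R (sym_group n)) = add ?F"
    by (simp_all add: group_algebra_def)
  have ker: "k \<in> ker_Psi R n r \<longleftrightarrow>
      k \<in> carrier ?F \<and> Psi R n r k = \<zero>\<^bsub>End_algebra R (tensor_power R n r)\<^esub>" for k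
    by (auto simp: ker_Psi_def a_kernel_def kernel_def ga)
  have Psi_e: "Psi R n r ?e = perm_op R n r w"
    unfolding Psi_def by (rule E.lin_ext_basis_vec[OF fin op w])
  have Psi_coset: "Psi R n r (k \<oplus>\<^bsub>?F\<^esub> ?e) = perm_op R n r w" if "k \<in> ker_Psi R n r" for k
    using that E.lin_ext_add[OF fin op _ basis_vec_closed, of k w] perm_op_closed[OF w] Psi_e
    unfolding ker by (simp add: Psi_def)
  \<comment> \<open>The zero vector, written as a multiple so that homogeneity of \<open>\<Psi>\<close> applies.\<close>
  have "\<zero> \<odot>\<^bsub>?F\<^esub> ?e \<in> ker_Psi R n r"
    unfolding ker Psi_def
    using E.lin_ext_smult[OF fin op zero_closed basis_vec_closed, of w]
      E.lin_ext_closed[OF fin op basis_vec_closed, of w] basis_vec_closed[of ?W w]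
    by simp
  then have "ker_Psi R n r \<noteq> {}"
    by blast
  moreover have "bar R n r w = (\<lambda>k. k \<oplus>\<^bsub>?F\<^esub> ?e) ` ker_Psi R n r"
    by (simp add: bar_def a_r_coset_def r_coset_def ga UNION_singleton_eq_range)
  then have "Psi R n r ` bar R n r w = (\<lambda>k. perm_op R n r w) ` ker_Psi R n r"
    by (simp only: image_image) (rule image_cong[OF refl Psi_coset])
  ultimately show ?thesis
    by (simp add: to_schur_def image_constant_conv)
qed

text \<open>Each Green operator is \<open>\<Psi>(w)\<close> cut down to one orbit; the orbits partition the basis of
  tensor space.\<close>

lemma perm_op_eq_sum_green_xi:
  assumes Orb: "Orb \<subseteq> multi_index n r"
    and rep: "\<forall>X\<in>place_orbits n r. \<exists>!i. i \<in> Orb \<inter> X"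
    and w: "w \<in> carrier (sym_group n)"
  shows "perm_op R n r w =
    (\<Oplus>\<^bsub>schur_algebra R n r\<^esub>i\<in>Orb. green_xi R n r (value_act r w i) i)"
proof -
  interpret T: module R "tensor_power R n r" by (rule module_tensor_power)
  interpret S: abelian_monoid "schur_algebra R n r" by (rule abelian_monoid_schur_algebra)
  have finOrb: "finite Orb"
    using Orb finite_multi_index finite_subset by blast
  have xi: "(\<lambda>i. green_xi R n r (value_act r w i) i) \<in> Orb \<rightarrow> carrier (schur_algebra R n r)"
    using green_xi_in_schur_algebra[OF w] by simp
  show ?thesis
  proof (rule tensor_endo_eqI)
    fix q assume q: "q \<in> multi_index n r"
    obtain i0 where i0: "i0 \<in> Orb"
      and iff: "\<And>i. i \<in> Orb \<Longrightarrow> q \<in> place_orbit r i \<longleftrightarrow> i0 = i"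
      by (rule place_orbit_representative[OF Orb rep q]) (rule that)
    have "(\<Oplus>\<^bsub>schur_algebra R n r\<^esub>i\<in>Orb. green_xi R n r (value_act r w i) i) (tensor_vec R n r q)
        = (\<Oplus>\<^bsub>tensor_power R n r\<^esub>i\<in>Orb.
            green_xi R n r (value_act r w i) i (tensor_vec R n r q))"
      by (rule T.finsum_endo_apply[OF abelian_monoid_schur_algebra _ _ _ finOrb xi])
        (auto simp: schur_algebra_simps tensor_vec_closed q)
    also have "\<dots> = (\<Oplus>\<^bsub>tensor_power R n r\<^esub>i\<in>Orb.
        if i0 = i then tensor_vec R n r (value_act r w q) else \<zero>\<^bsub>tensor_power R n r\<^esub>)"
      using q w by (intro T.finsum_cong')
        (auto simp: green_xi_tensor_vec iff tensor_vec_closed value_act_closed)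
    also have "\<dots> = tensor_vec R n r (value_act r w q)"
      using q w by (intro T.finsum_singleton[OF i0 finOrb])
        (auto simp: tensor_vec_closed value_act_closed)
    finally show "perm_op R n r w (tensor_vec R n r q) =
        (\<Oplus>\<^bsub>schur_algebra R n r\<^esub>i\<in>Orb. green_xi R n r (value_act r w i) i) (tensor_vec R n r q)"
      using q w by (simp add: perm_op_tensor_vec)
  next
    show "(\<Oplus>\<^bsub>schur_algebra R n r\<^esub>i\<in>Orb. green_xi R n r (value_act r w i) i)
        \<in> carrier (End_algebra R (tensor_power R n r))"
      using S.finsum_closed[OF xi] by (simp add: schur_algebra_simps)
  qed (rule perm_op_closed[OF w])
qed

end


section \<open>Canonical basis elements in Green's basis\<close>

theorem proposition5p4:
  fixes R :: "('a, 'm) ring_scheme"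
    and n r :: nat
    and Orb :: "(nat \<Rightarrow> nat) set"
    and w :: "nat \<Rightarrow> nat"
  assumes "cring R"
    and "n \<ge> 1"
    and "Orb \<subseteq> multi_index n r"
    and "\<forall>X\<in>place_orbits n r. \<exists>!i. i \<in> Orb \<inter> X"
    and "w \<in> lis_perms n r"
  shows "to_schur R n r (bar R n r w) =
    (\<Oplus>\<^bsub>schur_algebra R n r\<^esub>i\<in>Orb. green_xi R n r (value_act r w i) i)"
proof -
  have w: "w \<in> carrier (sym_group n)"
    using assms(5) by (simp add: lis_perms_def)
  show ?thesis
    unfolding cring.to_schur_bar[OF assms(1) w]
    by (rule cring.perm_op_eq_sum_green_xi[OF assms(1,3,4) w])
qed

end
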